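(* For every integer $d\ge3$ the space $\mathbb{R}^d$ admits a norm $\|\cdot\|$ such that: (1) the unit vector system $\mathcal{E}=(\boldsymbol{e}_j)_{j=1}^d$ and its dual basis $\mathcal{E}^*=(\boldsymbol{e}_j^* )_{j=1}^d$ are normalized and $1$-symmetric; (2) the basis $\mathcal{E}$ has Property (A); (3) the dual basis $\mathcal{E}^*$, regarded as a basis of the dual normed space $(\mathbb{R}^d,\|\cdot\|)^*$, fails Property (A).
   Context: Let $(\boldsymbol{x}_n)_{n=1}^d$ be a basis (in the linear algebra sense) of a $d$-dimensional real normed space $\mathbb{X}$, with dual basis $(\boldsymbol{x}_n^* )_{n=1}^d$, $\operatorname{supp}(f)=\{n:\boldsymbol{x}_n^*(f)\ne0\}$, and $\mathbb{1}_{\varepsilon,A}=\sum_{n\in A}\varepsilon_n\boldsymbol{x}_n$ for $A\subset\{1,\dots,d\}$ and signs $\varepsilon_n\in\{-1,1\}$. Property (A): $\|\mathbb{1}_{\varepsilon,A}+f\|\le\|\mathbb{1}_{\varepsilon,B}+f\|$ for all $f\in\mathbb{X}$ with $\max_n|\boldsymbol{x}_n^*(f)|\le1$, all $A,B\subset\{1,\dots,d\}$ with $|A|\le|B|$ and $A\cap B=A\cap\operatorname{supp}(f)=B\cap\operatorname{supp}(f)=\emptyset$, and all $\varepsilon\in\{-1,1\}^{A\cup B}$. Normalized: $\|\boldsymbol{x}_n\|=1$ for all $n$. $1$-symmetric: $\|\sum_{n=1}^d a_n\boldsymbol{x}_n\|\le\|\sum_{n=1}^d a_n\boldsymbol{x}_{\pi(n)}\|$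 for all scalars $a_1,\dots,a_d$ and all permutations $\pi$ of $\{1,\dots,d\}$. *)

theory Defs
  imports "HOL-Analysis.Analysis"
begin

text \<open>
  The norms under consideration are explicit functions \<open>N\<close> on a real vector space, since the
  statement asks for the existence of a norm; the class operation \<^const>\<open>norm\<close> is only used to
  know that all linear functionals on a Euclidean space are bounded. The \<open>d\<close> basis indices are the
  elements of a finite type \<open>'n\<close> with \<open>d = CARD('n)\<close>.
\<close>

definition is_norm :: "('a::real_vector \<Rightarrow> real) \<Rightarrow> bool" where
  "is_norm N \<longleftrightarrow>
     (\<forall>x. 0 \<le> N x) \<and> (\<forall>x. N x = 0 \<longleftrightarrow> x = 0) \<and>
     (\<forall>a x. N (a *\<^sub>R x) = \<bar>a\<bar> * N x) \<and> (\<forall>x y. N (x + y) \<le> N x + N y)"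

definition is_basis :: "('n::finite \<Rightarrow> 'a::real_vector) \<Rightarrow> bool" where
  "is_basis x \<longleftrightarrow> inj x \<and> independent (range x) \<and> span (range x) = UNIV"

text \<open>The coordinate functional \<open>x\<^sub>n\<^sup>*\<close> of the basis \<open>x\<close>.\<close>

definition coord :: "('n::finite \<Rightarrow> 'a::real_vector) \<Rightarrow> 'n \<Rightarrow> 'a \<Rightarrow> real" where
  "coord x n f = representation (range x) f (x n)"

definition supp :: "('n::finite \<Rightarrow> 'a::real_vector) \<Rightarrow> 'a \<Rightarrow> 'n set" where
  "supp x f = {n. coord x n f \<noteq> 0}"

definition signed_ind :: "('n::finite \<Rightarrow> 'a::real_vector) \<Rightarrow> ('n \<Rightarrow> real) \<Rightarrow> 'n set \<Rightarrow> 'a" where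
  "signed_ind x \<epsilon> A = (\<Sum>n\<in>A. \<epsilon> n *\<^sub>R x n)"

definition property_A :: "('a::real_vector \<Rightarrow> real) \<Rightarrow> ('n::finite \<Rightarrow> 'a) \<Rightarrow> bool" where
  "property_A N x \<longleftrightarrow>
     (\<forall>f A B \<epsilon>.
        (\<forall>n. \<bar>coord x n f\<bar> \<le> 1) \<longrightarrow> card A \<le> card B \<longrightarrow>
        A \<inter> B = {} \<longrightarrow> A \<inter> supp x f = {} \<longrightarrow> B \<inter> supp x f = {} \<longrightarrow>
        (\<forall>n\<in>A \<union> B. \<epsilon> n \<in> {-1, 1}) \<longrightarrow>
        N (signed_ind x \<epsilon> A + f) \<le> N (signed_ind x \<epsilon> B + f))"

definition normalized_basis :: "('a::real_vector \<Rightarrow> real) \<Rightarrow> ('n::finite \<Rightarrow> 'a) \<Rightarrow> bool" where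
  "normalized_basis N x \<longleftrightarrow> (\<forall>n. N (x n) = 1)"

definition one_symmetric :: "('a::real_vector \<Rightarrow> real) \<Rightarrow> ('n::finite \<Rightarrow> 'a) \<Rightarrow> bool" where
  "one_symmetric N x \<longleftrightarrow>
     (\<forall>(a :: 'n \<Rightarrow> real) \<pi>. \<pi> permutes UNIV \<longrightarrow>
        N (\<Sum>n\<in>UNIV. a n *\<^sub>R x n) \<le> N (\<Sum>n\<in>UNIV. a n *\<^sub>R x (\<pi> n)))"

definition unit_vectors :: "'n::finite \<Rightarrow> real ^ 'n" where
  "unit_vectors j = axis j 1"

text \<open>
  The dual space consists of all linear functionals; in finite dimension its carrier is the type
  \<open>'a \<Rightarrow>\<^sub>L real\<close>, whatever the norm \<open>N\<close>. The norm this type carries by its class instance is not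
  used: it is the dual of the Euclidean norm, whereas \<open>dual_norm N\<close> is the dual of \<open>N\<close>.
\<close>

definition dual_norm :: "('a::real_normed_vector \<Rightarrow> real) \<Rightarrow> ('a \<Rightarrow>\<^sub>L real) \<Rightarrow> real" where
  "dual_norm N \<phi> = (SUP x\<in>{x. N x \<le> 1}. \<bar>blinfun_apply \<phi> x\<bar>)"

definition dual_basis :: "('n::finite \<Rightarrow> 'a::euclidean_space) \<Rightarrow> 'n \<Rightarrow> ('a \<Rightarrow>\<^sub>L real)" where
  "dual_basis x n = Blinfun (coord x n)"

text \<open>
  The definitions above only have their intended meaning for bases and norms; the following facts
  confirm that this is the case wherever they are used.
\<close>

lemma coord_eqI:
  assumes "is_basis x" "f = (\<Sum>n\<in>UNIV. c n *\<^sub>R x n)"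
  shows "coord x n f = c n"
proof -
  have inj: "inj x" and ind: "independent (range x)" using assms by (auto simp: is_basis_def)
  have "representation (range x) f (x n) = (\<Sum>m\<in>UNIV. representation (range x) (c m *\<^sub>R x m) (x n))"
    unfolding assms(2)
    by (subst representation_sum) (auto simp: ind intro: span_scale span_base)
  also have "\<dots> = (\<Sum>m\<in>UNIV. if m = n then c m else 0)"
    by (intro sum.cong)
      (auto simp: representation_scale representation_basis ind span_base inj_eq[OF inj])
  also have "\<dots> = c n" by simp
  finally show ?thesis by (simp add: coord_def)
qed

lemma is_basis_unit_vectors: "is_basis (unit_vectors :: 'n::finite \<Rightarrow> real ^ 'n)"
proof -
  have "range (unit_vectors :: 'n \<Rightarrow> real ^ 'n) = Basis"
    by (auto simp: unit_vectors_def Basis_vec_def)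
  moreover have "inj (unit_vectors :: 'n \<Rightarrow> real ^ 'n)"
    by (auto simp: unit_vectors_def inj_def axis_eq_axis)
  ultimately show ?thesis
    by (simp add: is_basis_def independent_Basis)
qed

lemma vec_eq_sum_unit_vectors: "(f :: real ^ 'n::finite) = (\<Sum>n\<in>UNIV. (f $ n) *\<^sub>R unit_vectors n)"
  by (simp add: unit_vectors_def vec_eq_iff axis_def if_distrib cong: if_cong)

lemma coord_unit_vectors: "coord unit_vectors n f = f $ n"
  by (rule coord_eqI[OF is_basis_unit_vectors vec_eq_sum_unit_vectors])

lemma dual_basis_unit_vectors: "blinfun_apply (dual_basis unit_vectors n) f = f $ n"
proof -
  have "coord (unit_vectors :: 'a \<Rightarrow> _) n = (\<lambda>f. f $ n)"
    by (simp add: fun_eq_iff coord_unit_vectors)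
  then show ?thesis
    by (simp add: dual_basis_def bounded_linear_Blinfun_apply bounded_linear_vec_nth)
qed

lemma blinfun_eq_sum_dual_basis:
  "(\<phi> :: (real ^ 'n::finite) \<Rightarrow>\<^sub>L real) =
     (\<Sum>n\<in>UNIV. blinfun_apply \<phi> (unit_vectors n) *\<^sub>R dual_basis unit_vectors n)"
proof (rule blinfun_eqI)
  fix f :: "real ^ 'n"
  have "blinfun_apply \<phi> f = blinfun_apply \<phi> (\<Sum>n\<in>UNIV. (f $ n) *\<^sub>R unit_vectors n)"
    using vec_eq_sum_unit_vectors[of f] by simp
  then show "blinfun_apply \<phi> f =
      blinfun_apply (\<Sum>n\<in>UNIV. blinfun_apply \<phi> (unit_vectors n) *\<^sub>R dual_basis unit_vectors n) f"
    by (simp add: blinfun.sum_right blinfun.sum_left blinfun.scaleR_right blinfun.scaleR_left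
        dual_basis_unit_vectors mult.commute)
qed

lemma is_basis_dual_basis:
  "is_basis (dual_basis unit_vectors :: 'n::finite \<Rightarrow> (real ^ 'n) \<Rightarrow>\<^sub>L real)"
proof -
  let ?e = "dual_basis unit_vectors :: 'n \<Rightarrow> (real ^ 'n) \<Rightarrow>\<^sub>L real"
  have delta: "blinfun_apply (?e m) (unit_vectors n) = (if m = n then 1 else 0)" for m n
    by (simp add: dual_basis_unit_vectors unit_vectors_def axis_def)
  have inj: "inj ?e"
    by (rule injI) (metis delta zero_neq_one)
  have "u (?e m) = 0" if "(\<Sum>v\<in>range ?e. u v *\<^sub>R v) = 0" for u m
  proof -
    have "0 = blinfun_apply (\<Sum>n\<in>UNIV. u (?e n) *\<^sub>R ?e n) (unit_vectors m)"
      using that by (simp add: sum.reindex inj)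
    also have "\<dots> = u (?e m)"
      by (simp add: blinfun.sum_left blinfun.scaleR_left delta if_distrib cong: if_cong)
    finally show ?thesis by simp
  qed
  then have "independent (range ?e)"
    by (auto simp: dependent_finite)
  moreover have "\<phi> \<in> span (range ?e)" for \<phi>
    by (subst blinfun_eq_sum_dual_basis) (auto intro: span_sum span_scale span_base)
  ultimately show ?thesis
    using inj by (auto simp: is_basis_def)
qed

lemma coord_dual_basis: "coord (dual_basis unit_vectors) n \<phi> = blinfun_apply \<phi> (unit_vectors n)"
  by (rule coord_eqI[OF is_basis_dual_basis blinfun_eq_sum_dual_basis])

lemma is_norm_ge_norm:
  fixes N :: "'a::euclidean_space \<Rightarrow> real"
  assumes "is_norm N"
  obtains c where "c > 0" "\<And>x. c * norm x \<le> N x"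
proof -
  have nn: "0 \<le> N x" and N0: "N x = 0 \<longleftrightarrow> x = 0" and hom: "N (a *\<^sub>R x) = \<bar>a\<bar> * N x"
    and tri: "N (x + y) \<le> N x + N y" for a x y
    using assms by (auto simp: is_norm_def)
  have "convex_on UNIV N"
    unfolding convex_on_def using tri hom by (auto simp: abs_of_nonneg) (metis abs_of_nonneg hom tri)
  then have cont: "continuous_on UNIV N"
    by (intro convex_on_continuous) auto
  obtain b :: 'a where "norm b = 1" using vector_choose_size[of 1] by auto
  then have ne: "sphere (0::'a) 1 \<noteq> {}" by auto
  obtain s where s: "s \<in> sphere 0 1" "\<And>y. y \<in> sphere 0 1 \<Longrightarrow> N s \<le> N y"
    using continuous_attains_inf[OF compact_sphere ne continuous_on_subset[OF cont]] by auto
  have "N s > 0" using s(1) nn[of s] N0[of s] by (metis less_le mem_sphere_0 norm_zero zero_neq_one)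
  moreover have "N s * norm x \<le> N x" for x
  proof (cases "x = 0")
    case True then show ?thesis by (simp add: nn)
  next
    case False
    then have "N s \<le> N ((1 / norm x) *\<^sub>R x)" by (intro s(2)) simp
    also have "\<dots> = N x / norm x" by (simp add: hom)
    finally show ?thesis using False by (simp add: field_simps)
  qed
  ultimately show ?thesis by (rule that)
qed

lemma bdd_above_dual_norm:
  fixes N :: "'a::euclidean_space \<Rightarrow> real" and \<phi> :: "'a \<Rightarrow>\<^sub>L real"
  assumes "is_norm N"
  shows "bdd_above ((\<lambda>x. \<bar>blinfun_apply \<phi> x\<bar>) ` {x. N x \<le> 1})"
proof -
  obtain c where c: "c > 0" "\<And>x. c * norm x \<le> N x" using is_norm_ge_norm[OF assms] by blast
  have "\<bar>blinfun_apply \<phi> x\<bar> \<le> norm \<phi> * (1 / c)" if "N x \<le> 1" for x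
  proof -
    have "norm x \<le> 1 / c" using c(1) c(2)[of x] that by (simp add: field_simps)
    then show ?thesis
      using norm_blinfun[of \<phi> x] mult_left_mono[of "norm x" "1 / c" "norm \<phi>"] by simp
  qed
  then show ?thesis by (intro bdd_aboveI2) auto
qed

lemma is_norm_dual_norm:
  fixes N :: "'a::euclidean_space \<Rightarrow> real"
  assumes "is_norm N"
  shows "is_norm (dual_norm N)"
proof -
  have N0: "N 0 = 0" and hom: "N (a *\<^sub>R x) = \<bar>a\<bar> * N x" and nn: "0 \<le> N x" for a x
    using assms by (auto simp: is_norm_def)
  have ub: "\<bar>blinfun_apply \<phi> x\<bar> \<le> dual_norm N \<phi>" if "N x \<le> 1" for \<phi> x
    unfolding dual_norm_def using that by (intro cSUP_upper bdd_above_dual_norm assms) auto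
  have lub: "dual_norm N \<phi> \<le> M" if "\<And>x. N x \<le> 1 \<Longrightarrow> \<bar>blinfun_apply \<phi> x\<bar> \<le> M" for \<phi> M
    unfolding dual_norm_def using that N0 by (intro cSUP_least) (auto intro: exI[of _ 0])
  have nn': "0 \<le> dual_norm N \<phi>" for \<phi>
    using ub[of 0 \<phi>] by (simp add: N0)
  have zero: "\<phi> = 0" if "dual_norm N \<phi> = 0" for \<phi>
  proof (rule blinfun_eqI)
    fix x
    let ?t = "1 / (1 + N x)"
    have t: "?t > 0" using nn[of x] by simp
    have "N (?t *\<^sub>R x) \<le> 1" using nn[of x] by (simp add: hom)
    then have "?t * blinfun_apply \<phi> x = 0"
      using ub[of "?t *\<^sub>R x" \<phi>] that by (simp only: blinfun.scaleR_right) simp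
    then show "blinfun_apply \<phi> x = blinfun_apply 0 x" using t by simp
  qed
  have zero': "dual_norm N 0 = 0"
    using lub[of 0 0] nn'[of 0] by simp
  have scale_le: "dual_norm N (a *\<^sub>R \<phi>) \<le> \<bar>a\<bar> * dual_norm N \<phi>" for a \<phi>
    by (rule lub) (auto simp: blinfun.scaleR_left abs_mult intro!: mult_left_mono ub)
  have scale: "dual_norm N (a *\<^sub>R \<phi>) = \<bar>a\<bar> * dual_norm N \<phi>" for a \<phi>
  proof (cases "a = 0")
    case False
    then show ?thesis
      using scale_le[of a \<phi>] scale_le[of "inverse a" "a *\<^sub>R \<phi>"] by (simp add: field_simps)
  qed (simp add: zero')
  have "dual_norm N (\<phi> + \<psi>) \<le> dual_norm N \<phi> + dual_norm N \<psi>" for \<phi> \<psi>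
  proof (rule lub)
    fix x assume "N x \<le> 1"
    from ub[OF this, of \<phi>] ub[OF this, of \<psi>]
    show "\<bar>blinfun_apply (\<phi> + \<psi>) x\<bar> \<le> dual_norm N \<phi> + dual_norm N \<psi>"
      by (simp add: blinfun.add_left)
  qed
  then show ?thesis
    unfolding is_norm_def using nn' zero zero' scale by blast
qed

end

theory Submission
  imports Defs
begin

text \<open>
  Let \<open>d \<ge> 3\<close>. Cut the two corners \<open>(1,\<dots>,1)\<close> and \<open>-(1,\<dots>,1)\<close> off the cube \<open>[-1,1]\<^sup>d\<close>, moving
  them inwards to \<open>(1 - 1/d)(1,\<dots>,1)\<close> and its negative, and let \<open>N\<close> be the support function of the
  resulting polytope, so that the dual ball of \<open>N\<close> is the convex hull of the sign vectors that are
  not constant and of the two moved corners. Permuting coordinates preserves the polytope, hence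
  both bases are \<open>1\<close>-symmetric. They are normalized because the polytope lies in the cube and,
  for \<open>d \<ge> 3\<close>, still contains the coordinate functionals (\<open>coord_le_corner_cut_norm\<close>).

  As the polytope lies in the cube, \<open>N x\<close> is at most the \<open>\<ell>\<^sub>1\<close>-norm of \<open>x\<close>, and it equals the
  \<open>\<ell>\<^sub>1\<close>-norm unless all coordinates of \<open>x\<close> are nonzero and of one sign
  (\<open>corner_cut_norm_ge_l1\<close>). Property (A) for the unit vectors therefore only has content if
  \<open>f + 1\<^sub>B\<close> is such an exceptional vector. Then \<open>A\<close>, on which \<open>f + 1\<^sub>B\<close> vanishes, is empty, and the
  moved corner still gives
  \<open>N (f + 1\<^sub>B) \<ge> (1 - 1/d) (\<parallel>f\<parallel>\<^sub>1 + |B|)\<close>. This is at least \<open>\<parallel>f\<parallel>\<^sub>1\<close>, because \<open>\<parallel>f\<parallel>\<^sub>1 \<le> d - 1\<close>; the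
  corners have been moved exactly as far as this estimate permits.

  The dual norm fails Property (A) next to a cut corner. The vector \<open>(1,\<dots>,1,-1)\<close> is a vertex of the
  dual ball, so it has dual norm at most \<open>1\<close>. But the point \<open>(1,\<dots>,1,0)\<close> has been cut off
  together with the corner, so replacing the entry \<open>-1\<close> by \<open>0\<close> makes the dual norm larger.
\<close>

section \<open>Support functions of symmetric sets\<close>

definition support_norm :: "(real ^ 'n) set \<Rightarrow> real ^ 'n::finite \<Rightarrow> real" where
  "support_norm G x = (SUP g\<in>G. \<bar>\<Sum>i\<in>UNIV. g $ i * x $ i\<bar>)"

definition l1_norm :: "real ^ 'n::finite \<Rightarrow> real" where
  "l1_norm x = (\<Sum>i\<in>UNIV. \<bar>x $ i\<bar>)"

context
  fixes G :: "(real ^ 'n::finite) set"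
  assumes in_cube: "\<And>g i. g \<in> G \<Longrightarrow> \<bar>g $ i\<bar> \<le> 1"
begin

lemma pairing_le_l1:
  assumes "g \<in> G"
  shows "\<bar>\<Sum>i\<in>UNIV. g $ i * x $ i\<bar> \<le> l1_norm x"
proof -
  have "\<bar>\<Sum>i\<in>UNIV. g $ i * x $ i\<bar> \<le> (\<Sum>i\<in>UNIV. \<bar>g $ i * x $ i\<bar>)"
    by (rule sum_abs)
  also have "\<dots> \<le> l1_norm x"
    unfolding l1_norm_def
    by (intro sum_mono) (simp add: abs_mult in_cube[OF assms] mult_left_le_one_le)
  finally show ?thesis .
qed

lemma pairing_le_support_norm:
  assumes "g \<in> G"
  shows "\<bar>\<Sum>i\<in>UNIV. g $ i * x $ i\<bar> \<le> support_norm G x"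
  unfolding support_norm_def
  by (rule cSUP_upper[OF assms]) (auto intro!: bdd_aboveI2[where M = "l1_norm x"] pairing_le_l1)

lemma support_norm_le:
  assumes "G \<noteq> {}" "\<And>g. g \<in> G \<Longrightarrow> \<bar>\<Sum>i\<in>UNIV. g $ i * x $ i\<bar> \<le> M"
  shows "support_norm G x \<le> M"
  unfolding support_norm_def using assms by (intro cSUP_least)

lemma support_norm_le_l1:
  assumes "G \<noteq> {}"
  shows "support_norm G x \<le> l1_norm x"
  using assms pairing_le_l1 by (rule support_norm_le)

lemma is_norm_support_norm:
  assumes ne: "G \<noteq> {}" and coord_le: "\<And>x i. \<bar>x $ i\<bar> \<le> support_norm G x"
  shows "is_norm (support_norm G)"
proof -
  have nn: "0 \<le> support_norm G x" for x
    using coord_le abs_ge_zero order_trans by blast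
  have zero: "support_norm G 0 = 0"
    using nn[of 0] support_norm_le[OF ne, of 0 0] by simp
  have definite: "x = 0" if "support_norm G x = 0" for x
    using coord_le[of x] that by (simp add: vec_eq_iff)
  have scale_le: "support_norm G (a *\<^sub>R x) \<le> \<bar>a\<bar> * support_norm G x" for a x
  proof (rule support_norm_le[OF ne])
    fix g assume "g \<in> G"
    have "(\<Sum>i\<in>UNIV. g $ i * (a *\<^sub>R x) $ i) = a * (\<Sum>i\<in>UNIV. g $ i * x $ i)"
      by (simp add: sum_distrib_left mult_ac)
    then show "\<bar>\<Sum>i\<in>UNIV. g $ i * (a *\<^sub>R x) $ i\<bar> \<le> \<bar>a\<bar> * support_norm G x"
      using pairing_le_support_norm[OF \<open>g \<in> G\<close>] by (simp add: abs_mult mult_left_mono)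
  qed
  have scale: "support_norm G (a *\<^sub>R x) = \<bar>a\<bar> * support_norm G x" for a x
  proof (cases "a = 0")
    case False
    then show ?thesis
      using scale_le[of a x] scale_le[of "inverse a" "a *\<^sub>R x"] by (simp add: field_simps)
  qed (simp add: zero)
  have "support_norm G (x + y) \<le> support_norm G x + support_norm G y" for x y
  proof (rule support_norm_le[OF ne])
    fix g assume "g \<in> G"
    from pairing_le_support_norm[OF this, of x] pairing_le_support_norm[OF this, of y]
    show "\<bar>\<Sum>i\<in>UNIV. g $ i * (x + y) $ i\<bar> \<le> support_norm G x + support_norm G y"
      by (simp add: distrib_left sum.distrib)
  qed
  then show ?thesis
    unfolding is_norm_def using nn zero definite scale by blast
qed

lemma one_symmetric_support_norm:
  assumes ne: "G \<noteq> {}"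
    and perm: "\<And>g \<pi>. g \<in> G \<Longrightarrow> \<pi> permutes UNIV \<Longrightarrow> (\<chi> i. g $ \<pi> i) \<in> G"
  shows "one_symmetric (support_norm G) unit_vectors"
  unfolding one_symmetric_def
proof (intro allI impI)
  fix a :: "'n \<Rightarrow> real" and \<pi> :: "'n \<Rightarrow> 'n"
  assume \<pi>: "\<pi> permutes UNIV"
  let ?x = "\<Sum>n\<in>UNIV. a n *\<^sub>R unit_vectors n :: real ^ 'n"
  let ?y = "\<Sum>n\<in>UNIV. a n *\<^sub>R unit_vectors (\<pi> n) :: real ^ 'n"
  have x: "?x $ i = a i" for i
    by (simp add: unit_vectors_def axis_def if_distrib cong: if_cong)
  have y: "?y $ \<pi> i = a i" for i
    by (simp add: unit_vectors_def axis_def inj_eq[OF permutes_inj[OF \<pi>]] if_distrib cong: if_cong)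
  show "support_norm G ?x \<le> support_norm G ?y"
  proof (rule support_norm_le[OF ne])
    fix g assume g: "g \<in> G"
    let ?h = "\<chi> i. g $ inv \<pi> i"
    have "(\<Sum>i\<in>UNIV. g $ i * ?x $ i) = (\<Sum>i\<in>UNIV. ?h $ \<pi> i * ?y $ \<pi> i)"
      by (simp only: x y vec_lambda_beta permutes_inverses[OF \<pi>])
    also have "\<dots> = (\<Sum>i\<in>UNIV. ?h $ i * ?y $ i)"
      using sum.permute[OF \<pi>, of "\<lambda>i. ?h $ i * ?y $ i"] by (simp add: o_def)
    finally show "\<bar>\<Sum>i\<in>UNIV. g $ i * ?x $ i\<bar> \<le> support_norm G ?y"
      using pairing_le_support_norm[OF perm[OF g permutes_inv[OF \<pi>]], of ?y] by simp
  qed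
qed

end

section \<open>Dual norms\<close>

lemma is_norm_zero: "is_norm N \<Longrightarrow> N 0 = 0"
  unfolding is_norm_def by blast

lemma le_dual_norm:
  fixes N :: "'a::euclidean_space \<Rightarrow> real"
  assumes "is_norm N"
  shows "\<bar>blinfun_apply \<phi> x\<bar> \<le> dual_norm N \<phi> * N x"
proof (cases "x = 0")
  case True
  then show ?thesis by (simp add: is_norm_zero[OF assms])
next
  case False
  then have pos: "N x > 0"
    using assms by (simp add: is_norm_def less_le)
  then have "N ((1 / N x) *\<^sub>R x) \<le> 1"
    using assms by (simp add: is_norm_def)
  then have "\<bar>blinfun_apply \<phi> ((1 / N x) *\<^sub>R x)\<bar> \<le> dual_norm N \<phi>"
    unfolding dual_norm_def by (intro cSUP_upper bdd_above_dual_norm assms) auto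
  then show ?thesis
    using pos by (simp add: blinfun.scaleR_right field_simps)
qed

lemma dual_norm_le:
  fixes N :: "'a::euclidean_space \<Rightarrow> real"
  assumes "is_norm N" "\<And>x. N x \<le> 1 \<Longrightarrow> \<bar>blinfun_apply \<phi> x\<bar> \<le> M"
  shows "dual_norm N \<phi> \<le> M"
proof -
  have "N 0 \<le> 1" using is_norm_zero[OF assms(1)] by simp
  then show ?thesis
    unfolding dual_norm_def using assms(2) by (intro cSUP_least) auto
qed

lemma dual_basis_sum_apply:
  "blinfun_apply (\<Sum>n\<in>A. a n *\<^sub>R dual_basis unit_vectors (\<pi> n)) (x :: real ^ 'n::finite) =
     (\<Sum>n\<in>A. a n * x $ \<pi> n)"
  by (simp add: blinfun.sum_left blinfun.scaleR_left dual_basis_unit_vectors)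

lemma normalized_dual_basis:
  fixes N :: "real ^ 'n::finite \<Rightarrow> real"
  assumes N: "is_norm N" and norm1: "normalized_basis N unit_vectors"
    and coord_le: "\<And>x i. \<bar>x $ i\<bar> \<le> N x"
  shows "normalized_basis (dual_norm N) (dual_basis unit_vectors)"
  unfolding normalized_basis_def
proof
  fix n :: 'n
  have "dual_norm N (dual_basis unit_vectors n) \<le> 1"
    using coord_le by (intro dual_norm_le[OF N]) (force simp: dual_basis_unit_vectors intro: order_trans)
  moreover have "1 \<le> dual_norm N (dual_basis unit_vectors n)"
    using le_dual_norm[OF N, of "dual_basis unit_vectors n" "unit_vectors n"] norm1
    by (simp add: normalized_basis_def dual_basis_unit_vectors) (simp add: unit_vectors_def)
  ultimately show "dual_norm N (dual_basis unit_vectors n) = 1" by simp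
qed

text \<open>A permutation of the coordinates of a functional can be moved to its argument.\<close>

lemma one_symmetric_dual_basis:
  fixes N :: "real ^ 'n::finite \<Rightarrow> real"
  assumes N: "is_norm N" and sym: "one_symmetric N unit_vectors"
  shows "one_symmetric (dual_norm N) (dual_basis unit_vectors)"
  unfolding one_symmetric_def
proof (intro allI impI)
  fix a :: "'n \<Rightarrow> real" and \<pi> :: "'n \<Rightarrow> 'n"
  assume \<pi>: "\<pi> permutes UNIV"
  let ?\<phi> = "\<Sum>n\<in>UNIV. a n *\<^sub>R dual_basis unit_vectors n :: (real ^ 'n) \<Rightarrow>\<^sub>L real"
  let ?\<psi> = "\<Sum>n\<in>UNIV. a n *\<^sub>R dual_basis unit_vectors (\<pi> n) :: (real ^ 'n) \<Rightarrow>\<^sub>L real"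
  show "dual_norm N ?\<phi> \<le> dual_norm N ?\<psi>"
  proof (rule dual_norm_le[OF N])
    fix x :: "real ^ 'n" assume x: "N x \<le> 1"
    define y :: "real ^ 'n" where "y = (\<chi> m. x $ inv \<pi> m)"
    have "N y = N (\<Sum>m\<in>UNIV. (y $ m) *\<^sub>R unit_vectors m)"
      by (simp flip: vec_eq_sum_unit_vectors)
    also have "\<dots> \<le> N (\<Sum>m\<in>UNIV. (y $ m) *\<^sub>R unit_vectors (inv \<pi> m))"
      using sym permutes_inv[OF \<pi>] unfolding one_symmetric_def by blast
    also have "(\<Sum>m\<in>UNIV. (y $ m) *\<^sub>R unit_vectors (inv \<pi> m)) =
        (\<Sum>m\<in>UNIV. (x $ m) *\<^sub>R unit_vectors m)"
      using sum.permute[OF permutes_inv[OF \<pi>], of "\<lambda>m. (x $ m) *\<^sub>R unit_vectors m"]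
      by (simp add: y_def o_def)
    finally have "N y \<le> 1"
      using x by (simp flip: vec_eq_sum_unit_vectors)
    moreover have "0 \<le> dual_norm N ?\<psi>"
      using is_norm_dual_norm[OF N] by (simp add: is_norm_def)
    ultimately have "dual_norm N ?\<psi> * N y \<le> dual_norm N ?\<psi>"
      by (simp add: mult_left_le)
    moreover have "blinfun_apply ?\<phi> x = blinfun_apply ?\<psi> y"
      unfolding dual_basis_sum_apply dual_basis_sum_apply[where \<pi> = "\<lambda>n. n"]
      by (simp add: y_def permutes_inverses[OF \<pi>])
    ultimately show "\<bar>blinfun_apply ?\<phi> x\<bar> \<le> dual_norm N ?\<psi>"
      using le_dual_norm[OF N, of ?\<psi> y] by simp
  qed
qed

section \<open>The cube with two opposite corners cut\<close>

definition nonconstant_signs :: "(real ^ 'n::finite) set" where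
  "nonconstant_signs = {g. (\<forall>i. g $ i \<in> {-1, 1}) \<and> (\<exists>i j. g $ i \<noteq> g $ j)}"

text \<open>
  The moved corner opposite to \<open>1 - 1/d\<close> is left out: \<^const>\<open>support_norm\<close> takes absolute values,
  so it is the same for \<open>G\<close> and for \<open>G \<union> -G\<close>.
\<close>

definition cut_cube_vertices :: "(real ^ 'n::finite) set" where
  "cut_cube_vertices = insert (\<chi> i. 1 - 1 / CARD('n)) nonconstant_signs"

abbreviation corner_cut_norm :: "real ^ 'n::finite \<Rightarrow> real" where
  "corner_cut_norm \<equiv> support_norm cut_cube_vertices"

lemma cut_cube_vertices_nonempty: "cut_cube_vertices \<noteq> {}"
  by (simp add: cut_cube_vertices_def)

lemma cut_cube_vertices_in_cube:
  assumes "g \<in> (cut_cube_vertices :: (real ^ 'n::finite) set)"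
  shows "\<bar>g $ i\<bar> \<le> 1"
proof (cases "g \<in> nonconstant_signs")
  case True
  then have "g $ i \<in> {-1, 1}"
    unfolding nonconstant_signs_def by blast
  then show ?thesis by auto
next
  case False
  with assms have "g = (\<chi> i. 1 - 1 / CARD('n))"
    by (simp add: cut_cube_vertices_def)
  moreover have "CARD('n) \<ge> 1" by (simp add: Suc_leI)
  ultimately show ?thesis by (simp add: field_simps)
qed

lemma cut_cube_vertices_permute:
  assumes "g \<in> cut_cube_vertices" "\<pi> permutes UNIV"
  shows "(\<chi> i. g $ \<pi> i) \<in> cut_cube_vertices"
proof (cases "g \<in> nonconstant_signs")
  case True
  then obtain i j where "g $ i \<noteq> g $ j" and "\<forall>i. g $ i \<in> {-1, 1}"
    by (auto simp: nonconstant_signs_def)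
  then have "g $ \<pi> (inv \<pi> i) \<noteq> g $ \<pi> (inv \<pi> j)" "\<forall>i. g $ \<pi> i \<in> {-1, 1}"
    by (simp_all add: permutes_inverses[OF assms(2)])
  then have "(\<chi> i. g $ \<pi> i) \<in> nonconstant_signs"
    unfolding nonconstant_signs_def by (simp only: mem_Collect_eq vec_lambda_beta) blast
  then show ?thesis by (simp add: cut_cube_vertices_def)
next
  case False
  with assms(1) show ?thesis by (simp add: cut_cube_vertices_def)
qed

lemma pairing_le_corner_cut_norm:
  assumes "g \<in> cut_cube_vertices"
  shows "\<bar>\<Sum>i\<in>UNIV. g $ i * x $ i\<bar> \<le> corner_cut_norm x"
  using pairing_le_support_norm[OF cut_cube_vertices_in_cube assms] .

lemma nonconstant_sign_le_corner_cut_norm: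
  assumes "\<And>i. \<epsilon> i \<in> {-1, 1}" "\<epsilon> i \<noteq> \<epsilon> j"
  shows "\<bar>\<Sum>i\<in>UNIV. \<epsilon> i * x $ i\<bar> \<le> corner_cut_norm x"
proof -
  have "(\<chi> i. \<epsilon> i) \<in> nonconstant_signs"
    using assms unfolding nonconstant_signs_def by (simp only: mem_Collect_eq vec_lambda_beta) blast
  then show ?thesis
    using pairing_le_corner_cut_norm[of "\<chi> i. \<epsilon> i" x] by (simp add: cut_cube_vertices_def)
qed

lemma ex_not_in_small_set:
  assumes "card S < CARD('n)"
  obtains j where "j \<notin> (S :: 'n::finite set)"
  using assms by (metis UNIV_eq_I less_irrefl)

text \<open>
  Two sign vectors that agree at \<open>i\<close> and are opposite elsewhere have the average \<open>e\<^sub>i\<^sup>*\<close>. With three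
  coordinates at hand, both can be chosen nonconstant.
\<close>

lemma coord_le_corner_cut_norm:
  fixes x :: "real ^ 'n::finite"
  assumes "CARD('n) \<ge> 3"
  shows "\<bar>x $ i\<bar> \<le> corner_cut_norm x"
proof -
  obtain j k where jk: "j \<noteq> i" "k \<noteq> i" "k \<noteq> j"
  proof -
    obtain j where j: "j \<notin> {i}"
      using ex_not_in_small_set[of "{i}"] assms by auto
    obtain k where "k \<notin> {i, j}"
      using ex_not_in_small_set[of "{i, j}"] assms j by auto
    with j show ?thesis using that[of j k] by blast
  qed
  let ?\<epsilon> = "\<lambda>l. if l = i \<or> l = j then 1 else -1 :: real"
  let ?\<delta> = "\<lambda>l. if l = j then -1 else 1 :: real"
  have "(\<Sum>l\<in>UNIV. ?\<epsilon> l * x $ l) + (\<Sum>l\<in>UNIV. ?\<delta> l * x $ l) =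
      (\<Sum>l\<in>UNIV. if l = i then 2 * x $ l else 0)"
    unfolding sum.distrib[symmetric] using jk by (intro sum.cong) auto
  also have "\<dots> = 2 * x $ i" by simp
  finally have "2 * x $ i = (\<Sum>l\<in>UNIV. ?\<epsilon> l * x $ l) + (\<Sum>l\<in>UNIV. ?\<delta> l * x $ l)" by simp
  moreover have "\<bar>\<Sum>l\<in>UNIV. ?\<epsilon> l * x $ l\<bar> \<le> corner_cut_norm x"
    using jk by (intro nonconstant_sign_le_corner_cut_norm[where i = i and j = k]) auto
  moreover have "\<bar>\<Sum>l\<in>UNIV. ?\<delta> l * x $ l\<bar> \<le> corner_cut_norm x"
    using jk by (intro nonconstant_sign_le_corner_cut_norm[where i = i and j = j]) auto
  ultimately show ?thesis by linarith
qed

text \<open>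
  Some sign vector attains the \<open>\<ell>\<^sub>1\<close>-norm of \<open>x\<close>; the freedom to choose its sign at a zero of \<open>x\<close>
  makes it nonconstant even if the nonzero coordinates of \<open>x\<close> have one sign.
\<close>

lemma corner_cut_norm_ge_l1:
  fixes x :: "real ^ 'n::finite"
  assumes "i \<noteq> j" "x $ i * x $ j \<le> 0"
  shows "l1_norm x \<le> corner_cut_norm x"
proof -
  obtain p q where pq: "p \<noteq> q" "x $ p \<le> 0" "0 \<le> x $ q"
    using assms by (metis linear mult_le_0_iff)
  let ?\<epsilon> = "\<lambda>l. if l = p then -1 else if l = q then 1 else if x $ l \<ge> 0 then 1 else -1 :: real"
  have "l1_norm x = (\<Sum>l\<in>UNIV. ?\<epsilon> l * x $ l)"
    unfolding l1_norm_def using pq by (intro sum.cong) auto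
  also have "\<dots> \<le> corner_cut_norm x"
    by (rule order_trans[OF abs_ge_self nonconstant_sign_le_corner_cut_norm[where i = p and j = q]])
      (use pq in auto)
  finally show ?thesis .
qed

lemma corner_cut_norm_ge_abs_sum:
  fixes x :: "real ^ 'n::finite"
  shows "(1 - 1 / CARD('n)) * \<bar>\<Sum>i\<in>UNIV. x $ i\<bar> \<le> corner_cut_norm x"
proof -
  let ?c = "1 - 1 / real CARD('n)"
  have "?c \<ge> 0" by (simp add: Suc_leI)
  then have "?c * \<bar>\<Sum>i\<in>UNIV. x $ i\<bar> = \<bar>\<Sum>i\<in>UNIV. (\<chi> i. ?c) $ i * x $ i\<bar>"
    by (simp add: abs_mult flip: sum_distrib_left)
  also have "\<dots> \<le> corner_cut_norm x"
    by (rule pairing_le_corner_cut_norm) (simp_all add: cut_cube_vertices_def)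
  finally show ?thesis .
qed

lemma is_norm_corner_cut_norm:
  assumes "CARD('n::finite) \<ge> 3"
  shows "is_norm (corner_cut_norm :: real ^ 'n \<Rightarrow> real)"
  using is_norm_support_norm[OF cut_cube_vertices_in_cube cut_cube_vertices_nonempty]
    coord_le_corner_cut_norm[OF assms] by blast

lemma one_symmetric_corner_cut_norm: "one_symmetric corner_cut_norm unit_vectors"
  using one_symmetric_support_norm[OF cut_cube_vertices_in_cube cut_cube_vertices_nonempty]
    cut_cube_vertices_permute by blast

lemma corner_cut_norm_le_l1: "corner_cut_norm x \<le> l1_norm x"
  using support_norm_le_l1[OF cut_cube_vertices_in_cube cut_cube_vertices_nonempty] .

lemma normalized_corner_cut_norm:
  assumes "CARD('n::finite) \<ge> 3"
  shows "normalized_basis corner_cut_norm (unit_vectors :: 'n \<Rightarrow> real ^ 'n)"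
  unfolding normalized_basis_def
proof
  fix n :: 'n
  have "l1_norm (unit_vectors n) = 1"
    by (simp add: l1_norm_def unit_vectors_def axis_def if_distrib cong: if_cong)
  moreover have "unit_vectors n $ n = 1"
    by (simp add: unit_vectors_def)
  ultimately show "corner_cut_norm (unit_vectors n) = 1"
    using corner_cut_norm_le_l1[of "unit_vectors n"]
      coord_le_corner_cut_norm[OF assms, of "unit_vectors n" n] by simp
qed

section \<open>Property (A) for the unit vectors\<close>

lemma signed_ind_unit_vectors: "signed_ind unit_vectors \<epsilon> A $ i = (if i \<in> A then \<epsilon> i else 0)"
  by (simp add: signed_ind_def unit_vectors_def axis_def if_distrib cong: if_cong)

lemma l1_norm_signed_ind_add:
  assumes "\<forall>n\<in>A. \<epsilon> n \<in> {-1, 1}" "A \<inter> supp unit_vectors f = {}"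
  shows "l1_norm (signed_ind unit_vectors \<epsilon> A + f) = card A + l1_norm f"
proof -
  have "l1_norm (signed_ind unit_vectors \<epsilon> A + f) =
      (\<Sum>i\<in>UNIV. (if i \<in> A then 1 else 0) + \<bar>f $ i\<bar>)"
    unfolding l1_norm_def
  proof (rule sum.cong)
    fix i
    have "f $ i = 0" if "i \<in> A"
      using that assms(2) by (auto simp: supp_def coord_unit_vectors)
    moreover have "\<bar>\<epsilon> i\<bar> = 1" if "i \<in> A"
      using that assms(1) by force
    ultimately show "\<bar>(signed_ind unit_vectors \<epsilon> A + f) $ i\<bar> = (if i \<in> A then 1 else 0) + \<bar>f $ i\<bar>"
      by (simp add: signed_ind_unit_vectors)
  qed simp
  then show ?thesis
    by (simp add: sum.distrib l1_norm_def sum.If_cases)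
qed

lemma property_A_corner_cut_norm:
  assumes d3: "CARD('n::finite) \<ge> 3"
  shows "property_A corner_cut_norm (unit_vectors :: 'n \<Rightarrow> real ^ 'n)"
  unfolding property_A_def
proof (intro allI impI)
  fix f :: "real ^ 'n" and A B \<epsilon>
  assume f: "\<forall>n. \<bar>coord unit_vectors n f\<bar> \<le> 1" and AB: "card A \<le> card B" "A \<inter> B = {}"
    and A: "A \<inter> supp unit_vectors f = {}" and B: "B \<inter> supp unit_vectors f = {}"
    and \<epsilon>: "\<forall>n\<in>A \<union> B. \<epsilon> n \<in> {-1, 1::real}"
  let ?a = "signed_ind unit_vectors \<epsilon> A + f" and ?b = "signed_ind unit_vectors \<epsilon> B + f"
  have la: "l1_norm ?a = card A + l1_norm f"
    using \<epsilon> A by (intro l1_norm_signed_ind_add) auto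
  have lb: "l1_norm ?b = card B + l1_norm f"
    using \<epsilon> B by (intro l1_norm_signed_ind_add) auto
  show "corner_cut_norm ?a \<le> corner_cut_norm ?b"
  proof (cases "\<exists>i j. i \<noteq> j \<and> ?b $ i * ?b $ j \<le> 0")
    case True
    then have "l1_norm ?b \<le> corner_cut_norm ?b"
      using corner_cut_norm_ge_l1 by blast
    then show ?thesis
      using corner_cut_norm_le_l1[of ?a] la lb AB(1) by linarith
  next
    case one_sign: False
    have nz: "?b $ i \<noteq> 0" for i
    proof -
      obtain j where "j \<notin> {i}"
        using ex_not_in_small_set[of "{i}"] d3 by auto
      then show ?thesis using one_sign by force
    qed
    have "A = {}"
    proof (rule ccontr)
      assume "A \<noteq> {}"
      then obtain i where "i \<in> A" by blast
      then have "?b $ i = 0"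
        using AB(2) A by (auto simp: signed_ind_unit_vectors supp_def coord_unit_vectors)
      with nz show False by blast
    qed
    show ?thesis
    proof (cases "B = {}")
      case True
      with \<open>A = {}\<close> show ?thesis by simp
    next
      case False
      then have B1: "card B \<ge> 1" by (simp add: Suc_leI card_gt_0_iff)
      let ?d = "real CARD('n)"
      have "l1_norm f = (\<Sum>i\<in>-B. \<bar>f $ i\<bar>)"
        unfolding l1_norm_def using B
        by (intro sum.mono_neutral_right) (auto simp: supp_def coord_unit_vectors)
      also have "\<dots> \<le> card (- B)"
        using f sum_bounded_above[of "- B" "\<lambda>i. \<bar>f $ i\<bar>" 1] by (simp add: coord_unit_vectors)
      also have "\<dots> \<le> ?d - 1"
        using B1 card_Diff_subset[of B UNIV] card_mono[of UNIV B]
        by (simp flip: Compl_eq_Diff_UNIV)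
      finally have lf: "l1_norm f \<le> ?d - 1" .
      obtain i0 :: 'n where True by blast
      have same: "?b $ i * ?b $ i0 > 0" if "i \<noteq> i0" for i
        using one_sign that by (meson not_le)
      have "(\<forall>i. ?b $ i > 0) \<or> (\<forall>i. ?b $ i < 0)"
      proof (cases "?b $ i0 > 0")
        case True
        have "?b $ i > 0" for i
          using True same[of i] unfolding zero_less_mult_iff by (cases "i = i0") force+
        then show ?thesis by blast
      next
        case False
        then have neg: "?b $ i0 < 0" using nz[of i0] by linarith
        have "?b $ i < 0" for i
          using neg same[of i] unfolding zero_less_mult_iff by (cases "i = i0") force+
        then show ?thesis by blast
      qed
      then have sum_b: "\<bar>\<Sum>i\<in>UNIV. ?b $ i\<bar> = l1_norm ?b"
        unfolding l1_norm_def
      proof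
        assume pos: "\<forall>i. ?b $ i > 0"
        then have "(\<Sum>i\<in>UNIV. ?b $ i) \<ge> 0" by (intro sum_nonneg) (simp add: less_imp_le)
        moreover have "(\<Sum>i\<in>UNIV. \<bar>?b $ i\<bar>) = (\<Sum>i\<in>UNIV. ?b $ i)"
          using pos by (intro sum.cong) (auto simp: abs_of_pos)
        ultimately show "\<bar>\<Sum>i\<in>UNIV. ?b $ i\<bar> = (\<Sum>i\<in>UNIV. \<bar>?b $ i\<bar>)" by simp
      next
        assume neg: "\<forall>i. ?b $ i < 0"
        then have "(\<Sum>i\<in>UNIV. ?b $ i) \<le> 0" by (intro sum_nonpos) (simp add: less_imp_le)
        moreover have "(\<Sum>i\<in>UNIV. \<bar>?b $ i\<bar>) = (\<Sum>i\<in>UNIV. - (?b $ i))"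
          using neg by (intro sum.cong) (auto simp: abs_of_neg)
        ultimately show "\<bar>\<Sum>i\<in>UNIV. ?b $ i\<bar> = (\<Sum>i\<in>UNIV. \<bar>?b $ i\<bar>)"
          by (simp only: sum_negf)
      qed
      have "l1_norm f \<le> (1 - 1 / ?d) * (1 + l1_norm f)"
        using lf d3 by (simp add: field_simps)
      also have "\<dots> \<le> (1 - 1 / ?d) * l1_norm ?b"
        using B1 d3 unfolding lb by (intro mult_left_mono) auto
      also have "\<dots> \<le> corner_cut_norm ?b"
        using corner_cut_norm_ge_abs_sum[of ?b] by (simp only: sum_b)
      finally show ?thesis
        using corner_cut_norm_le_l1[of ?a] la \<open>A = {}\<close> by simp
    qed
  qed
qed

section \<open>Failure of Property (A) for the dual basis\<close>

text \<open>
  Among the vectors equal to \<open>1\<close> off \<open>k\<close>, the norm is least where the contributions of the sign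
  vectors and of the moved corner balance; up to a factor, this vector takes the value \<open>2d - 1\<close> off
  \<open>k\<close> and \<open>d - 1\<close> at \<open>k\<close>. It separates the point with coordinate \<open>0\<close> at \<open>k\<close> and \<open>1\<close> elsewhere from
  the dual ball.
\<close>

lemma corner_cut_norm_separating_le:
  fixes k :: "'n::finite"
  defines "d \<equiv> real CARD('n)"
  assumes d3: "CARD('n) \<ge> 3"
  shows "corner_cut_norm (\<chi> i. if i = k then d - 1 else 2 * d - 1) \<le> 2 * (d - 1)\<^sup>2"
    (is "corner_cut_norm ?x \<le> _")
proof (rule support_norm_le[OF cut_cube_vertices_in_cube cut_cube_vertices_nonempty])
  fix g :: "real ^ 'n" assume g: "g \<in> cut_cube_vertices"
  have "d \<ge> 3" using d3 by (simp add: d_def)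
  then have x: "?x $ i \<ge> d - 1" for i by auto
  have x_sum: "(\<Sum>i\<in>UNIV. ?x $ i) = 2 * d * (d - 1)"
  proof -
    have "(\<Sum>i\<in>UNIV. ?x $ i) = (\<Sum>i\<in>UNIV. (2 * d - 1) - (if i = k then d else 0))"
      by (intro sum.cong) auto
    also have "\<dots> = 2 * d * (d - 1)"
      unfolding sum_subtractf by (simp add: d_def algebra_simps)
    finally show ?thesis .
  qed
  show "\<bar>\<Sum>i\<in>UNIV. g $ i * ?x $ i\<bar> \<le> 2 * (d - 1)\<^sup>2"
  proof (cases "g \<in> nonconstant_signs")
    case True
    then have signs: "g $ i \<in> {-1, 1}" for i
      unfolding nonconstant_signs_def by blast
    from True obtain i j where "g $ i \<noteq> g $ j"
      by (auto simp: nonconstant_signs_def)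
    then obtain p q where p: "g $ p = 1" and q: "g $ q = -1"
      using signs[of i] signs[of j] by auto
    \<comment> \<open>An entry \<open>-1\<close> costs at least twice the smallest coordinate. Both \<open>g\<close> and \<open>-g\<close> have one.\<close>
    have loss: "(\<Sum>i\<in>UNIV. h i * ?x $ i) \<le> 2 * (d - 1)\<^sup>2"
      if h: "h r = -1" "\<And>i. h i \<in> {-1, 1}" for h and r :: 'n
    proof -
      have "(\<Sum>i\<in>UNIV. h i * ?x $ i) \<le> (\<Sum>i\<in>UNIV. ?x $ i - (if i = r then 2 * (d - 1) else 0))"
      proof (rule sum_mono)
        fix i
        show "h i * ?x $ i \<le> ?x $ i - (if i = r then 2 * (d - 1) else 0)"
          using h(1) h(2)[of i] x[of i] \<open>d \<ge> 3\<close> by (cases "i = r") auto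
      qed
      also have "\<dots> = 2 * (d - 1)\<^sup>2"
        unfolding sum_subtractf x_sum by (simp add: power2_eq_square algebra_simps)
      finally show ?thesis .
    qed
    have "(\<Sum>i\<in>UNIV. g $ i * ?x $ i) \<le> 2 * (d - 1)\<^sup>2"
      using q signs by (intro loss[where r = q]) auto
    moreover have "(\<Sum>i\<in>UNIV. - (g $ i) * ?x $ i) \<le> 2 * (d - 1)\<^sup>2"
      using p signs by (intro loss[where r = p]) force+
    ultimately show ?thesis
      unfolding mult_minus_left sum_negf by linarith
  next
    case False
    with g have "g = (\<chi> i. 1 - 1 / d)"
      by (simp add: cut_cube_vertices_def d_def)
    then have "(\<Sum>i\<in>UNIV. g $ i * ?x $ i) = (1 - 1 / d) * (\<Sum>i\<in>UNIV. ?x $ i)"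
      by (simp only: vec_lambda_beta sum_distrib_left)
    also have "\<dots> = 2 * (d - 1)\<^sup>2"
      unfolding x_sum using \<open>d \<ge> 3\<close> by (simp add: field_simps power2_eq_square)
    finally show ?thesis by simp
  qed
qed

lemma not_property_A_dual_corner_cut_norm:
  assumes d3: "CARD('n::finite) \<ge> 3"
  shows "\<not> property_A (dual_norm corner_cut_norm)
           (dual_basis unit_vectors :: 'n \<Rightarrow> (real ^ 'n) \<Rightarrow>\<^sub>L real)"
proof
  let ?D = "dual_norm corner_cut_norm :: ((real ^ 'n) \<Rightarrow>\<^sub>L real) \<Rightarrow> real"
  let ?e = "dual_basis unit_vectors :: 'n \<Rightarrow> (real ^ 'n) \<Rightarrow>\<^sub>L real"
  assume A: "property_A ?D ?e"
  note N = is_norm_corner_cut_norm[OF d3]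
  define d where "d = real CARD('n)"
  have "d \<ge> 3" using d3 by (simp add: d_def)
  obtain k :: 'n where True by blast
  define f where "f = (\<Sum>n\<in>UNIV. (if n = k then 0 else 1) *\<^sub>R ?e n)"
  have f: "blinfun_apply f x = (\<Sum>n\<in>UNIV. (if n = k then 0 else 1) * x $ n)" for x
    unfolding f_def by (rule dual_basis_sum_apply)
  have coord_f: "coord ?e n f = (if n = k then 0 else 1)" for n
    by (rule coord_eqI[OF is_basis_dual_basis f_def])
  have "?D (signed_ind ?e (\<lambda>_. -1) {} + f) \<le> ?D (signed_ind ?e (\<lambda>_. -1) {k} + f)"
    using A unfolding property_A_def
    by (elim allE[of _ f] allE[of _ "{}"] allE[of _ "{k}"] allE[of _ "\<lambda>_. -1"])
      (auto simp: coord_f supp_def)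
  then have "?D f \<le> ?D (f - ?e k)"
    by (simp add: signed_ind_def)
  also have "\<dots> \<le> 1"
  proof (rule dual_norm_le[OF N])
    fix x :: "real ^ 'n" assume x: "corner_cut_norm x \<le> 1"
    let ?\<epsilon> = "\<lambda>n. if n = k then -1 else 1 :: real"
    obtain j where "j \<notin> {k}"
      using ex_not_in_small_set[of "{k}"] d3 by auto
    have "blinfun_apply (f - ?e k) x =
        (\<Sum>n\<in>UNIV. (if n = k then 0 else 1) * x $ n - (if n = k then x $ n else 0))"
      by (simp add: blinfun.diff_left f dual_basis_unit_vectors sum_subtractf)
    also have "\<dots> = (\<Sum>n\<in>UNIV. ?\<epsilon> n * x $ n)"
      by (intro sum.cong) auto
    finally have "\<bar>blinfun_apply (f - ?e k) x\<bar> = \<bar>\<Sum>n\<in>UNIV. ?\<epsilon> n * x $ n\<bar>" by simp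
    also have "\<dots> \<le> corner_cut_norm x"
      using \<open>j \<notin> {k}\<close> by (intro nonconstant_sign_le_corner_cut_norm[where i = j and j = k]) auto
    finally show "\<bar>blinfun_apply (f - ?e k) x\<bar> \<le> 1"
      using x by simp
  qed
  finally have "?D f \<le> 1" .
  let ?x = "(\<chi> i. if i = k then d - 1 else 2 * d - 1) :: real ^ 'n"
  have "blinfun_apply f ?x = (\<Sum>n\<in>UNIV. (2 * d - 1) - (if n = k then 2 * d - 1 else 0))"
    unfolding f by (intro sum.cong) auto
  also have "\<dots> = (d - 1) * (2 * d - 1)"
    unfolding sum_subtractf by (simp add: d_def algebra_simps)
  finally have "(d - 1) * (2 * d - 1) \<le> \<bar>blinfun_apply f ?x\<bar>" by simp
  also have "\<dots> \<le> ?D f * corner_cut_norm ?x"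
    by (rule le_dual_norm[OF N])
  also have "\<dots> \<le> 1 * corner_cut_norm ?x"
    using \<open>?D f \<le> 1\<close> N by (intro mult_right_mono) (auto simp: is_norm_def)
  also have "\<dots> \<le> 2 * (d - 1)\<^sup>2"
    using corner_cut_norm_separating_le[OF d3, of k] unfolding d_def by simp
  finally show False
    using \<open>d \<ge> 3\<close> by (simp add: power2_eq_square algebra_simps)
qed

theorem proposition4p2:
  assumes "CARD('n::finite) \<ge> 3"
  shows "\<exists>N :: real ^ 'n \<Rightarrow> real. is_norm N \<and>
           normalized_basis N unit_vectors \<and>
           one_symmetric N unit_vectors \<and>
           normalized_basis (dual_norm N) (dual_basis unit_vectors) \<and>
           one_symmetric (dual_norm N) (dual_basis unit_vectors) \<and>
           property_A N unit_vectors \<and>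
           \<not> property_A (dual_norm N) (dual_basis unit_vectors)"
  using is_norm_corner_cut_norm[OF assms] normalized_corner_cut_norm[OF assms]
    one_symmetric_corner_cut_norm
    normalized_dual_basis[OF is_norm_corner_cut_norm[OF assms] normalized_corner_cut_norm[OF assms]
      coord_le_corner_cut_norm[OF assms]]
    one_symmetric_dual_basis[OF is_norm_corner_cut_norm[OF assms] one_symmetric_corner_cut_norm]
    property_A_corner_cut_norm[OF assms] not_property_A_dual_corner_cut_norm[OF assms]
  by (intro exI[of _ corner_cut_norm] conjI)

end
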